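(* Let $P(s)$ be a single-input single-output plant with real minimal realization $(A,B,C,D)$, let $$K(s)=k_p+\frac{k_i}{s+\varepsilon},\qquad \varepsilon>0,$$ be a (leaky) PI controller, put $\rho=[k_p,k_i]^T$, and let $\sigma>0$, $\omega_c>0$. Define $$A_L=\begin{bmatrix} -\varepsilon & 0 \\ B & A \end{bmatrix},\quad \mathcal M_B=\begin{bmatrix} 0 & 1 \\ B & 0 \end{bmatrix},\quad C_L=\begin{bmatrix} D & C \end{bmatrix},\quad \mathcal M_D=\begin{bmatrix} D & 0 \end{bmatrix}.$$ Suppose there exist Hermitian matrices $X$ and $Q$ (of the size of $A_L$) and a vector $\rho=[k_p,k_i]^T\ge0$ (entrywise) such that $Q\succeq0$ and $$\begin{bmatrix} \Xi_{11} & \Xi_{12} & \Xi_{13} \\ \Xi_{12}^H & \Xi_{22} & \Xi_{23} \\ \Xi_{13}^H & \Xi_{23}^H & -1 \end{bmatrix}\preceq0,$$ where $$\Xi_{11}=A_LX+XA_L^T-A_LQA_L^T+\omega_c^2Q,\qquad \Xi_{12}=XC_L^T-A_LQC_L^T-\tfrac1{2\sigma}\mathcal M_B\rho,$$ $$\Xi_{22}=-C_LQC_L^T-\tfrac1\sigma\mathcal M_D\rho,\qquad \Xi_{13}=\mathcal M_B\rho,\qquad \Xi_{23}=\mathcal M_D\rho .$$ Then the open-loop transfer function $G(s)=P(s)K(s)$, with these $k_p,k_i$, satisfies $$G(j\omega)\in\mathcal P_{\rm PD}(\sigma)\qquad\text{for all }\omega\text{ with }-\omega_c\le\omega\le\omega_c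 .$$
   Context: $P(s)=C(sI-A)^{-1}B+D$. For $\sigma>0$ the positive damping region is the closed disk $\mathcal P_{\rm PD}(\sigma)=\{z\in\mathbb C:\ |z-\tfrac1{2\sigma}|\le\tfrac1{2\sigma}\}$. $M\succeq0$ ($\preceq0$) means Hermitian positive (negative) semidefinite; $M^T$ is the transpose and $M^H$ the conjugate transpose. The system $G(s)=P(s)K(s)$ has the state-space realization $(A_L,\ \mathcal M_B\rho,\ C_L,\ \mathcal M_D\rho)$. *)

theory Defs
  imports
    "Jordan_Normal_Form.Matrix"
    "Jordan_Normal_Form.Determinant"
    "Jordan_Normal_Form.Gauss_Jordan_Elimination"
    "Jordan_Normal_Form.Schur_Decomposition"
    Complex_Main
begin

abbreviation cmat :: "real mat \<Rightarrow> complex mat" where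
  "cmat \<equiv> map_mat complex_of_real"

definition append_cols :: "'a :: zero mat \<Rightarrow> 'a mat \<Rightarrow> 'a mat" (infixr "@\<^sub>c" 65) where
  "M @\<^sub>c N = four_block_mat M N (0\<^sub>m 0 (dim_col M)) (0\<^sub>m 0 (dim_col N))"

definition hermitian_mat :: "complex mat \<Rightarrow> bool" where
  "hermitian_mat M \<longleftrightarrow> square_mat M \<and> mat_adjoint M = M"

(* For Hermitian M the form below is real, so taking Re loses nothing. *)
definition psd :: "complex mat \<Rightarrow> bool" where
  "psd M \<longleftrightarrow> hermitian_mat M \<and>
     (\<forall>v \<in> carrier_vec (dim_row M). Re ((M *\<^sub>v v) \<bullet>c v) \<ge> 0)"

definition nsd :: "complex mat \<Rightarrow> bool" where
  "nsd M \<longleftrightarrow> hermitian_mat M \<and>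
     (\<forall>v \<in> carrier_vec (dim_row M). Re ((M *\<^sub>v v) \<bullet>c v) \<le> 0)"

definition siso_dims :: "nat \<Rightarrow> real mat \<Rightarrow> real mat \<Rightarrow> real mat \<Rightarrow> real mat \<Rightarrow> bool" where
  "siso_dims n A B C D \<longleftrightarrow>
     A \<in> carrier_mat n n \<and> B \<in> carrier_mat n 1 \<and> C \<in> carrier_mat 1 n \<and> D \<in> carrier_mat 1 1"

definition pencil :: "real mat \<Rightarrow> complex \<Rightarrow> complex mat" where
  "pencil A s = s \<cdot>\<^sub>m 1\<^sub>m (dim_row A) - cmat A"

(* If s is an eigenvalue of A, then mat_inverse returns None and the value is unspecified. *)
definition siso_tf :: "real mat \<Rightarrow> real mat \<Rightarrow> real mat \<Rightarrow> real mat \<Rightarrow> complex \<Rightarrow> complex" where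
  "siso_tf A B C D s = (cmat C * the (mat_inverse (pencil A s)) * cmat B + cmat D) $$ (0, 0)"

(* Equality of the transfer functions as rational functions: they agree wherever both
   resolvents exist, i.e. at all but finitely many points. *)
definition same_tf ::
  "real mat \<Rightarrow> real mat \<Rightarrow> real mat \<Rightarrow> real mat \<Rightarrow>
   real mat \<Rightarrow> real mat \<Rightarrow> real mat \<Rightarrow> real mat \<Rightarrow> bool" where
  "same_tf A B C D A' B' C' D' \<longleftrightarrow>
     (\<forall>s. det (pencil A s) \<noteq> 0 \<and> det (pencil A' s) \<noteq> 0 \<longrightarrow>
        siso_tf A B C D s = siso_tf A' B' C' D' s)"

(* Minimality means least state dimension among all real realizations of the same transfer
   function. Dimension 0 (a static plant) is allowed. *)
definition minimal_realization ::
  "nat \<Rightarrow> real mat \<Rightarrow> real mat \<Rightarrow> real mat \<Rightarrow> real mat \<Rightarrow> bool" where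
  "minimal_realization n A B C D \<longleftrightarrow> siso_dims n A B C D \<and>
     (\<forall>m A' B' C' D'. siso_dims m A' B' C' D' \<and> same_tf A B C D A' B' C' D' \<longrightarrow> n \<le> m)"

definition leaky_PI :: "real \<Rightarrow> real \<Rightarrow> real \<Rightarrow> complex \<Rightarrow> complex" where
  "leaky_PI \<epsilon> kp ki s = complex_of_real kp + complex_of_real ki / (s + complex_of_real \<epsilon>)"

definition PD_region :: "real \<Rightarrow> complex set" where
  "PD_region \<sigma> = {z. cmod (z - complex_of_real (1 / (2 * \<sigma>))) \<le> 1 / (2 * \<sigma>)}"

definition loop_A :: "real \<Rightarrow> real mat \<Rightarrow> real mat \<Rightarrow> real mat" where
  "loop_A \<epsilon> A B = four_block_mat ((- \<epsilon>) \<cdot>\<^sub>m 1\<^sub>m 1) (0\<^sub>m 1 (dim_col A)) B A"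

definition loop_MB :: "real mat \<Rightarrow> real mat" where
  "loop_MB B = four_block_mat (0\<^sub>m 1 1) (1\<^sub>m 1) B (0\<^sub>m (dim_row B) 1)"

definition loop_C :: "real mat \<Rightarrow> real mat \<Rightarrow> real mat" where
  "loop_C C D = D @\<^sub>c C"

definition loop_MD :: "real mat \<Rightarrow> real mat" where
  "loop_MD D = D @\<^sub>c 0\<^sub>m 1 1"

definition gain_vec :: "real \<Rightarrow> real \<Rightarrow> real mat" where
  "gain_vec kp ki = mat_of_rows_list 1 [[kp], [ki]]"

definition block3 ::
  "'a :: zero mat \<Rightarrow> 'a mat \<Rightarrow> 'a mat \<Rightarrow>
   'a mat \<Rightarrow> 'a mat \<Rightarrow> 'a mat \<Rightarrow>
   'a mat \<Rightarrow> 'a mat \<Rightarrow> 'a mat \<Rightarrow> 'a mat" where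
  "block3 M11 M12 M13 M21 M22 M23 M31 M32 M33 =
     four_block_mat (four_block_mat M11 M12 M21 M22) (M13 @\<^sub>r M23) (M31 @\<^sub>c M32) M33"

end

(* If A_L^T xi + C_L^T eta = conj(s) xi with s = i omega, then evaluating the LMI at (xi, eta, g),
   where g = (M_B rho)^H xi + (M_D rho)^H eta, cancels the X-terms and leaves
     |g|^2 - Re(eta conj(g)) / sigma + (omega_c^2 - omega^2) xi^H Q xi <= 0.
   If s is not an eigenvalue of A, such a xi exists for eta = 1; then g = conj(G(s)), and the
   inequality is the disk condition.
   If s is an eigenvalue of A, take eta = 0 and xi extending a left eigenvector z of A: then
   g = conj(K(s)) B^T z must vanish. But B^T z = 0 contradicts minimality: the controllability matrix
   would be singular, and a Krylov basis B, A B, ..., A^(k-1) B with k < n would give a smaller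
   realization. So K(s) = 0, and P(s) K(s) = 0 even though P(s) is a junk value. *)
theory Submission
  imports Defs
begin

section \<open>Adjoints and the complex scalar product\<close>

lemma mat_adjoint_dim [simp]: "dim_row (mat_adjoint M) = dim_col M" "dim_col (mat_adjoint M) = dim_row M"
  by (simp_all add: mat_adjoint_def)

lemma mat_adjoint_carrier [simp]: "M \<in> carrier_mat nr nc \<Longrightarrow> mat_adjoint M \<in> carrier_mat nc nr"
  by auto

lemma mat_adjoint_index [simp]:
  "i < dim_col M \<Longrightarrow> j < dim_row M \<Longrightarrow> mat_adjoint M $$ (i, j) = conjugate (M $$ (j, i))"
  by (simp add: mat_adjoint_def mat_of_rows_def cols_def)

lemma mat_adjoint_cmat [simp]: "mat_adjoint (cmat M) = transpose_mat (cmat M)"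
  by (intro eq_matI) auto

text \<open>The product \<open>\<bullet>c\<close> conjugates its second argument, so the rule
  reduces to the bilinear one for the transpose, applied to \<open>conjugate y\<close>.\<close>

lemma cscalar_mult_adjoint:
  fixes M :: "complex mat"
  assumes "M \<in> carrier_mat nr nc" "x \<in> carrier_vec nc" "y \<in> carrier_vec nr"
  shows "(M *\<^sub>v x) \<bullet>c y = x \<bullet>c (mat_adjoint M *\<^sub>v y)"
proof -
  have "conjugate (mat_adjoint M *\<^sub>v y) = transpose_mat M *\<^sub>v conjugate y"
    using assms by (intro eq_vecI) (auto simp: scalar_prod_def sum_conjugate)
  moreover have "(M *\<^sub>v x) \<bullet>c y = (transpose_mat M *\<^sub>v conjugate y) \<bullet> x"
    using assms transpose_vec_mult_scalar[OF assms(1,2), of "conjugate y"]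
      comm_scalar_prod[of "M *\<^sub>v x" nr "conjugate y"] by simp
  ultimately show ?thesis
    using assms comm_scalar_prod[of x nc "transpose_mat M *\<^sub>v conjugate y"] by simp
qed

lemma cscalar_commute:
  fixes x y :: "complex vec"
  assumes "x \<in> carrier_vec n" "y \<in> carrier_vec n"
  shows "y \<bullet>c x = cnj (x \<bullet>c y)"
  using assms by (simp add: scalar_prod_def mult.commute)

lemma cscalar_distrib:
  fixes x y z :: "complex vec"
  assumes "x \<in> carrier_vec n" "y \<in> carrier_vec n" "z \<in> carrier_vec n"
  shows "(x + y) \<bullet>c z = x \<bullet>c z + y \<bullet>c z" "(x - y) \<bullet>c z = x \<bullet>c z - y \<bullet>c z"
    "x \<bullet>c (y + z) = x \<bullet>c y + x \<bullet>c z"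
  using assms by (simp_all add: scalar_prod_def sum.distrib sum_subtractf algebra_simps)

lemma cscalar_scale:
  fixes x y :: "complex vec"
  assumes "x \<in> carrier_vec n" "y \<in> carrier_vec n"
  shows "(- x) \<bullet>c y = - (x \<bullet>c y)" "(c \<cdot>\<^sub>v x) \<bullet>c y = c * (x \<bullet>c y)"
    "x \<bullet>c (c \<cdot>\<^sub>v y) = cnj c * (x \<bullet>c y)"
  using assms by (simp_all add: scalar_prod_def sum_negf sum_distrib_left algebra_simps)

lemma mat_adjoint_mult:
  fixes M N :: "complex mat"
  assumes "M \<in> carrier_mat r k" "N \<in> carrier_mat k l"
  shows "mat_adjoint (M * N) = mat_adjoint N * mat_adjoint M"
  using assms by (intro eq_matI) (auto simp: scalar_prod_def mult.commute)

lemma smult_mat_mult_vec: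
  fixes M :: "complex mat"
  assumes "M \<in> carrier_mat nr nc" "x \<in> carrier_vec nc"
  shows "(c \<cdot>\<^sub>m M) *\<^sub>v x = c \<cdot>\<^sub>v (M *\<^sub>v x)"
  using assms by (intro eq_vecI) auto

section \<open>Block matrices and the matrix inequality at a test vector\<close>

lemma append_cols_mult_vec:
  fixes M N :: "'a :: comm_ring_1 mat"
  assumes "M \<in> carrier_mat r n1" "N \<in> carrier_mat r n2" "x \<in> carrier_vec n1" "y \<in> carrier_vec n2"
  shows "(M @\<^sub>c N) *\<^sub>v (x @\<^sub>v y) = M *\<^sub>v x + N *\<^sub>v y"
proof -
  \<comment> \<open>The four-block encoding has two lower blocks without rows; they append a vector
    of length 0, which the next equation drops.\<close>
  have "(M @\<^sub>c N) *\<^sub>v (x @\<^sub>v y) = (M *\<^sub>v x + N *\<^sub>v y) @\<^sub>v (0\<^sub>m 0 n1 *\<^sub>v x + 0\<^sub>m 0 n2 *\<^sub>v y)"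
    unfolding append_cols_def using assms four_block_mat_mult_vec[of M r n1 N n2 "0\<^sub>m 0 n1" 0 "0\<^sub>m 0 n2" x y]
    by (simp add: carrier_matD(2)[OF assms(1)] carrier_matD(2)[OF assms(2)])
  also have "\<dots> = M *\<^sub>v x + N *\<^sub>v y"
    by (intro eq_vecI) auto
  finally show ?thesis .
qed

text \<open>The vector is split as \<open>(x @\<^sub>v y) @\<^sub>v z\<close> because
  \<open>block3\<close> nests its blocks in the same way: the outer split separates the third block
  from the rest, the inner one separates the first two.\<close>

lemma block3_form:
  fixes M11 :: "complex mat"
  assumes [simp]: "M11 \<in> carrier_mat n1 n1" "M12 \<in> carrier_mat n1 n2" "M13 \<in> carrier_mat n1 n3"
    "M21 \<in> carrier_mat n2 n1" "M22 \<in> carrier_mat n2 n2" "M23 \<in> carrier_mat n2 n3"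
    "M31 \<in> carrier_mat n3 n1" "M32 \<in> carrier_mat n3 n2" "M33 \<in> carrier_mat n3 n3"
    and [simp]: "x \<in> carrier_vec n1" "y \<in> carrier_vec n2" "z \<in> carrier_vec n3"
  shows "(block3 M11 M12 M13 M21 M22 M23 M31 M32 M33 *\<^sub>v ((x @\<^sub>v y) @\<^sub>v z)) \<bullet>c ((x @\<^sub>v y) @\<^sub>v z)
    = (M11 *\<^sub>v x) \<bullet>c x + (M12 *\<^sub>v y) \<bullet>c x + (M13 *\<^sub>v z) \<bullet>c x
    + (M21 *\<^sub>v x) \<bullet>c y + (M22 *\<^sub>v y) \<bullet>c y + (M23 *\<^sub>v z) \<bullet>c y
    + (M31 *\<^sub>v x) \<bullet>c z + (M32 *\<^sub>v y) \<bullet>c z + (M33 *\<^sub>v z) \<bullet>c z"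
proof -
  have [simp]: "dim_vec x = n1" "dim_vec y = n2" "dim_vec z = n3" by (auto intro: carrier_vecD)
  have conj_append: "conjugate (u @\<^sub>v v) = conjugate u @\<^sub>v conjugate v" for u v :: "complex vec"
    by (intro eq_vecI) auto
  have [simp]: "dim_row M13 = n1" "dim_row M23 = n2" "dim_col M31 = n1" "dim_col M32 = n2"
    by (rule assms(3,6)[THEN carrier_matD(1)] assms(7,8)[THEN carrier_matD(2)])+
  have mv [simp]: "M *\<^sub>v v \<in> carrier_vec r" if "M \<in> carrier_mat r k" "v \<in> carrier_vec k"
    for M :: "complex mat" and v r k
    using that by (rule mult_mat_vec_carrier)
  note [simp] = mv[of _ n1 n1] mv[of _ n1 n2] mv[of _ n1 n3] mv[of _ n2 n1] mv[of _ n2 n2] mv[of _ n2 n3]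
    mv[of _ n3 n1] mv[of _ n3 n2] mv[of _ n3 n3]
  have rowc: "M31 @\<^sub>c M32 \<in> carrier_mat n3 (n1 + n2)"
    using four_block_carrier_mat[of M31 n3 n1 "0\<^sub>m 0 n2" 0 n2] by (simp add: append_cols_def)
  have "block3 M11 M12 M13 M21 M22 M23 M31 M32 M33 *\<^sub>v ((x @\<^sub>v y) @\<^sub>v z)
    = (((M11 *\<^sub>v x + M12 *\<^sub>v y) @\<^sub>v (M21 *\<^sub>v x + M22 *\<^sub>v y)) + (M13 *\<^sub>v z @\<^sub>v M23 *\<^sub>v z))
      @\<^sub>v ((M31 *\<^sub>v x + M32 *\<^sub>v y) + M33 *\<^sub>v z)"
    unfolding block3_def
    by (subst four_block_mat_mult_vec[of _ "n1 + n2" "n1 + n2" _ n3 _ n3])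
      (auto simp: rowc append_cols_mult_vec[of _ n3 n1 _ n2] mat_mult_append[of _ n1 n3 _ n2] four_block_mat_mult_vec[of _ n1 n1 _ n2 _ n2])
  also have "\<dots> = ((M11 *\<^sub>v x + M12 *\<^sub>v y + M13 *\<^sub>v z) @\<^sub>v (M21 *\<^sub>v x + M22 *\<^sub>v y + M23 *\<^sub>v z))
      @\<^sub>v (M31 *\<^sub>v x + M32 *\<^sub>v y + M33 *\<^sub>v z)"
    by (subst append_vec_add[of _ n1 _ _ n2]) (auto intro: add_carrier_vec mv)
  finally show ?thesis
    by (simp add: conj_append scalar_prod_append[of _ "n1 + n2" _ n3] scalar_prod_append[of _ n1 _ n2]
        cscalar_distrib[of _ n1] cscalar_distrib[of _ n2] cscalar_distrib[of _ n3])
qed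

text \<open>Restriction to the subspace cut out by \<open>eq\<close>, as in the generalized
  Kalman-Yakubovich-Popov lemma, for any number \<open>m\<close> of channels and complex data.
  Taking \<open>g\<close> as the third block of the test vector amounts to the Schur complement of
  the corner block \<open>- 1\<^sub>m m\<close>.\<close>

lemma gkyp_test_vector:
  fixes A C X Q b d :: "complex mat" and \<omega> \<omega>\<^sub>c \<sigma> :: real
  defines "X11 \<equiv> A * X + X * mat_adjoint A - A * Q * mat_adjoint A + complex_of_real (\<omega>\<^sub>c\<^sup>2) \<cdot>\<^sub>m Q"
    and "X12 \<equiv> X * mat_adjoint C - A * Q * mat_adjoint C - complex_of_real (1 / (2 * \<sigma>)) \<cdot>\<^sub>m b"
    and "X22 \<equiv> - (C * Q * mat_adjoint C) - complex_of_real (1 / \<sigma>) \<cdot>\<^sub>m d"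
  assumes [simp]: "A \<in> carrier_mat N N" "C \<in> carrier_mat m N" "X \<in> carrier_mat N N"
      "Q \<in> carrier_mat N N" "b \<in> carrier_mat N m" "d \<in> carrier_mat m m"
    and X: "hermitian_mat X" and Q: "psd Q"
    and LMI: "nsd (block3 X11 X12 b (mat_adjoint X12) X22 d (mat_adjoint b) (mat_adjoint d) (- 1\<^sub>m m))"
    and \<omega>: "\<bar>\<omega>\<bar> \<le> \<omega>\<^sub>c"
    and [simp]: "\<xi> \<in> carrier_vec N" "\<eta> \<in> carrier_vec m"
    and eq: "mat_adjoint A *\<^sub>v \<xi> + mat_adjoint C *\<^sub>v \<eta> = cnj (\<i> * complex_of_real \<omega>) \<cdot>\<^sub>v \<xi>"
  defines "g \<equiv> mat_adjoint b *\<^sub>v \<xi> + mat_adjoint d *\<^sub>v \<eta>"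
  shows "Re (g \<bullet>c g) \<le> Re (\<eta> \<bullet>c g) / \<sigma>"
proof -
  have [simp]: "g \<in> carrier_vec m"
    unfolding g_def by (intro add_carrier_vec mult_mat_vec_carrier[of _ m N] mult_mat_vec_carrier[of _ m m])
      simp_all
  note [simp] = mult_mat_vec_carrier[of _ N N] mult_mat_vec_carrier[of _ N m]
    mult_mat_vec_carrier[of _ m N] mult_mat_vec_carrier[of _ m m]
  note sN = cscalar_distrib[of _ N] cscalar_scale[of _ N] and sm = cscalar_distrib[of _ m] cscalar_scale[of _ m]
  have cX: "X11 \<in> carrier_mat N N" "X12 \<in> carrier_mat N m" "X22 \<in> carrier_mat m m"
    unfolding X11_def X12_def X22_def by (auto intro!: minus_carrier_mat mult_carrier_mat)
  \<comment> \<open>Every \<open>A\<close> and \<open>C\<close> in the quadratic form is moved onto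
    \<open>\<xi>\<close> or \<open>\<eta>\<close>, so that only \<open>u\<close> and
    \<open>w\<close> remain; \<open>eq\<close> fixes their sum.\<close>
  define u where "u = mat_adjoint A *\<^sub>v \<xi>"
  define w where "w = mat_adjoint C *\<^sub>v \<eta>"
  define s where "s = \<i> * complex_of_real \<omega>"
  have [simp]: "u \<in> carrier_vec N" "w \<in> carrier_vec N"
    unfolding u_def w_def by (simp_all add: mult_mat_vec_carrier[of _ N N] mult_mat_vec_carrier[of _ N m])
  have uw: "u + w = cnj s \<cdot>\<^sub>v \<xi>" using eq by (simp add: u_def w_def s_def)
  have adjA: "(A *\<^sub>v x) \<bullet>c \<xi> = x \<bullet>c u" if "x \<in> carrier_vec N" for x
    using cscalar_mult_adjoint[of A N N x \<xi>] that by (simp add: u_def)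
  have adjC: "(C *\<^sub>v x) \<bullet>c \<eta> = x \<bullet>c w" if "x \<in> carrier_vec N" for x
    using cscalar_mult_adjoint[of C m N x \<eta>] that by (simp add: w_def)
  have XH: "(X *\<^sub>v x) \<bullet>c y = cnj ((X *\<^sub>v y) \<bullet>c x)" if "x \<in> carrier_vec N" "y \<in> carrier_vec N" for x y
    using that X cscalar_mult_adjoint[of X N N x y] cscalar_commute[of "X *\<^sub>v y" N x]
    by (simp add: hermitian_mat_def)
  have QH: "(Q *\<^sub>v x) \<bullet>c y = cnj ((Q *\<^sub>v y) \<bullet>c x)" if "x \<in> carrier_vec N" "y \<in> carrier_vec N" for x y
    using that Q cscalar_mult_adjoint[of Q N N x y] cscalar_commute[of "Q *\<^sub>v y" N x]
    by (simp add: psd_def hermitian_mat_def)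
  have amv: "(L * M) *\<^sub>v x = L *\<^sub>v (M *\<^sub>v x)"
    if "L \<in> carrier_mat r k" "M \<in> carrier_mat k l" "x \<in> carrier_vec l" for L M :: "complex mat" and x r k l
    using that by (rule assoc_mult_mat_vec)
  have e11: "(X11 *\<^sub>v \<xi>) \<bullet>c \<xi> = (X *\<^sub>v \<xi>) \<bullet>c u + (X *\<^sub>v u) \<bullet>c \<xi> - (Q *\<^sub>v u) \<bullet>c u
      + complex_of_real (\<omega>\<^sub>c\<^sup>2) * ((Q *\<^sub>v \<xi>) \<bullet>c \<xi>)"
  proof -
    have "X11 *\<^sub>v \<xi> = A *\<^sub>v (X *\<^sub>v \<xi>) + X *\<^sub>v u - A *\<^sub>v (Q *\<^sub>v u) + complex_of_real (\<omega>\<^sub>c\<^sup>2) \<cdot>\<^sub>v (Q *\<^sub>v \<xi>)"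
      by (simp add: X11_def u_def add_mult_distrib_mat_vec[of _ N N] minus_mult_distrib_mat_vec[of _ N N]
          minus_carrier_mat[of _ N N] amv[of _ N N _ N] mult_carrier_mat[of _ N N _ N] smult_mat_mult_vec[of _ N N])
    then show ?thesis by (simp add: sN adjA)
  qed
  have e12: "(X12 *\<^sub>v \<eta>) \<bullet>c \<xi> = (X *\<^sub>v w) \<bullet>c \<xi> - (Q *\<^sub>v w) \<bullet>c u
      - complex_of_real (1 / (2 * \<sigma>)) * ((b *\<^sub>v \<eta>) \<bullet>c \<xi>)"
  proof -
    have "X12 *\<^sub>v \<eta> = X *\<^sub>v w - A *\<^sub>v (Q *\<^sub>v w) - complex_of_real (1 / (2 * \<sigma>)) \<cdot>\<^sub>v (b *\<^sub>v \<eta>)"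
      by (simp add: X12_def w_def minus_mult_distrib_mat_vec[of _ N m]
          minus_carrier_mat[of _ N m] amv[of _ N N _ m] amv[of _ N N _ N] mult_carrier_mat[of _ N N _ N] mult_carrier_mat[of _ N N _ m] smult_mat_mult_vec[of _ N m])
    then show ?thesis by (simp add: sN adjA)
  qed
  have e22: "(X22 *\<^sub>v \<eta>) \<bullet>c \<eta> = - ((Q *\<^sub>v w) \<bullet>c w) - complex_of_real (1 / \<sigma>) * ((d *\<^sub>v \<eta>) \<bullet>c \<eta>)"
  proof -
    have "X22 *\<^sub>v \<eta> = - (C *\<^sub>v (Q *\<^sub>v w)) - complex_of_real (1 / \<sigma>) \<cdot>\<^sub>v (d *\<^sub>v \<eta>)"
      by (simp add: X22_def w_def carrier_vecD[of \<eta> m] carrier_matD(1)[of C m N] minus_mult_distrib_mat_vec[of _ m m]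
          minus_carrier_mat[of _ m m] amv[of _ m N _ m] amv[of _ m N _ N] mult_carrier_mat[of _ m N _ N] mult_carrier_mat[of _ m N _ m] smult_mat_mult_vec[of _ m m])
    then show ?thesis by (simp add: sm adjC)
  qed
  have e21: "(mat_adjoint X12 *\<^sub>v \<xi>) \<bullet>c \<eta> = cnj ((X12 *\<^sub>v \<eta>) \<bullet>c \<xi>)"
    using cscalar_mult_adjoint[of X12 N m \<eta> \<xi>] cscalar_commute[of "mat_adjoint X12 *\<^sub>v \<xi>" m \<eta>] cX
    by simp
  have g1: "(b *\<^sub>v y) \<bullet>c \<xi> + (d *\<^sub>v y) \<bullet>c \<eta> = y \<bullet>c g" if "y \<in> carrier_vec m" for y
    using that cscalar_mult_adjoint[of b N m y \<xi>] cscalar_mult_adjoint[of d m m y \<eta>]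
    by (simp add: g_def sm)
  have g2: "(mat_adjoint b *\<^sub>v \<xi>) \<bullet>c g + (mat_adjoint d *\<^sub>v \<eta>) \<bullet>c g = g \<bullet>c g"
    by (simp add: g_def sm)
  have e33: "(- 1\<^sub>m m *\<^sub>v g) \<bullet>c g = - (g \<bullet>c g)"
    by (simp add: sm)
  \<comment> \<open>Hermitian symmetry of \<open>X\<close> turns the conjugated term into
    \<open>(X *\<^sub>v \<xi>) \<bullet>c w\<close>. The factor is \<open>s\<close> in one equation
    and \<open>cnj s\<close> in the other because \<open>\<bullet>c\<close> conjugates its second
    argument.\<close>
  have Xsum: "(X *\<^sub>v \<xi>) \<bullet>c u + cnj ((X *\<^sub>v w) \<bullet>c \<xi>) = s * ((X *\<^sub>v \<xi>) \<bullet>c \<xi>)"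
    "(X *\<^sub>v u) \<bullet>c \<xi> + (X *\<^sub>v w) \<bullet>c \<xi> = cnj s * ((X *\<^sub>v \<xi>) \<bullet>c \<xi>)"
  proof -
    have "(X *\<^sub>v \<xi>) \<bullet>c u + (X *\<^sub>v \<xi>) \<bullet>c w = (X *\<^sub>v \<xi>) \<bullet>c (u + w)"
      by (simp add: sN)
    then show "(X *\<^sub>v \<xi>) \<bullet>c u + cnj ((X *\<^sub>v w) \<bullet>c \<xi>) = s * ((X *\<^sub>v \<xi>) \<bullet>c \<xi>)"
      by (simp add: uw sN XH[of w \<xi>])
    have "(X *\<^sub>v u) \<bullet>c \<xi> + (X *\<^sub>v w) \<bullet>c \<xi> = (X *\<^sub>v (u + w)) \<bullet>c \<xi>"
      by (simp add: sN mult_add_distrib_mat_vec[of _ N N])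
    then show "(X *\<^sub>v u) \<bullet>c \<xi> + (X *\<^sub>v w) \<bullet>c \<xi> = cnj s * ((X *\<^sub>v \<xi>) \<bullet>c \<xi>)"
      by (simp add: uw sN mult_mat_vec[of _ N N])
  qed
  \<comment> \<open>The four terms form the quadratic form of \<open>Q\<close> at
    \<open>u + w\<close>, and the scalar \<open>cnj s\<close> leaves it through both arguments as
    \<open>cnj s * s\<close>.\<close>
  have Qsum: "(Q *\<^sub>v u) \<bullet>c u + (Q *\<^sub>v w) \<bullet>c u + cnj ((Q *\<^sub>v w) \<bullet>c u) + (Q *\<^sub>v w) \<bullet>c w
      = complex_of_real (\<omega>\<^sup>2) * ((Q *\<^sub>v \<xi>) \<bullet>c \<xi>)"
  proof -
    have "(Q *\<^sub>v u) \<bullet>c u + (Q *\<^sub>v w) \<bullet>c u + (Q *\<^sub>v u) \<bullet>c w + (Q *\<^sub>v w) \<bullet>c w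
        = (Q *\<^sub>v (u + w)) \<bullet>c (u + w)"
      by (simp add: sN mult_add_distrib_mat_vec[of _ N N])
    also have "\<dots> = cnj s * s * ((Q *\<^sub>v \<xi>) \<bullet>c \<xi>)"
      by (simp add: uw sN mult_mat_vec[of _ N N])
    also have "cnj s * s = complex_of_real (\<omega>\<^sup>2)"
      by (simp add: s_def power2_eq_square complex_eq_iff)
    finally show ?thesis using QH[of w u] by simp
  qed
  let ?v = "(\<xi> @\<^sub>v \<eta>) @\<^sub>v g"
  let ?M = "block3 X11 X12 b (mat_adjoint X12) X22 d (mat_adjoint b) (mat_adjoint d) (- 1\<^sub>m m)"
  have "dim_row ?M = N + m + m"
    using cX by (simp add: block3_def append_rows_def append_cols_def)
  then have "Re ((?M *\<^sub>v ?v) \<bullet>c ?v) \<le> 0"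
    using LMI by (auto simp: nsd_def)
  moreover have "(?M *\<^sub>v ?v) \<bullet>c ?v = (X11 *\<^sub>v \<xi>) \<bullet>c \<xi> + (X12 *\<^sub>v \<eta>) \<bullet>c \<xi> + (b *\<^sub>v g) \<bullet>c \<xi>
     + (mat_adjoint X12 *\<^sub>v \<xi>) \<bullet>c \<eta> + (X22 *\<^sub>v \<eta>) \<bullet>c \<eta> + (d *\<^sub>v g) \<bullet>c \<eta>
     + (mat_adjoint b *\<^sub>v \<xi>) \<bullet>c g + (mat_adjoint d *\<^sub>v \<eta>) \<bullet>c g + (- 1\<^sub>m m *\<^sub>v g) \<bullet>c g"
    using cX by (intro block3_form) auto
  \<comment> \<open>The block below the diagonal is the adjoint of \<open>X12\<close>, so
    \<open>X12\<close> counts twice in the real part. The terms in \<open>b\<close> and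
    \<open>d\<close> with third block \<open>g\<close> contribute \<open>g \<bullet>c g\<close>
    twice, and the corner block takes one copy away.\<close>
  ultimately have "Re ((X11 *\<^sub>v \<xi>) \<bullet>c \<xi>) + 2 * Re ((X12 *\<^sub>v \<eta>) \<bullet>c \<xi>) + Re ((X22 *\<^sub>v \<eta>) \<bullet>c \<eta>) + Re (g \<bullet>c g) \<le> 0"
    using g1[of g] g2 e33 e21 by (simp add: complex_eq_iff)
  moreover have "Re ((X11 *\<^sub>v \<xi>) \<bullet>c \<xi>) + 2 * Re ((X12 *\<^sub>v \<eta>) \<bullet>c \<xi>) + Re ((X22 *\<^sub>v \<eta>) \<bullet>c \<eta>)
      = (\<omega>\<^sub>c\<^sup>2 - \<omega>\<^sup>2) * Re ((Q *\<^sub>v \<xi>) \<bullet>c \<xi>) - Re (\<eta> \<bullet>c g) / \<sigma>"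
  proof -
    \<comment> \<open>Since \<open>s\<close> is purely imaginary, \<open>s * t\<close> and
      \<open>cnj s * t\<close> have opposite real parts for every complex \<open>t\<close>; hence
      the \<open>X\<close> terms cancel.\<close>
    have x: "Re ((X *\<^sub>v \<xi>) \<bullet>c u) + Re ((X *\<^sub>v u) \<bullet>c \<xi>) + 2 * Re ((X *\<^sub>v w) \<bullet>c \<xi>) = 0"
      using Xsum by (simp add: complex_eq_iff s_def)
    have q: "Re ((Q *\<^sub>v u) \<bullet>c u) + 2 * Re ((Q *\<^sub>v w) \<bullet>c u) + Re ((Q *\<^sub>v w) \<bullet>c w) = \<omega>\<^sup>2 * Re ((Q *\<^sub>v \<xi>) \<bullet>c \<xi>)"
      using arg_cong[OF Qsum, of Re] by simp
    \<comment> \<open>The coefficient \<open>1 / (2 * \<sigma>)\<close> of \<open>b\<close> is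
      doubled by the adjoint pair of off-diagonal blocks. It then matches the coefficient
      \<open>1 / \<sigma>\<close> of \<open>d\<close>, and both terms combine into the pairing of
      \<open>\<eta>\<close> with \<open>g\<close>.\<close>
    have r: "Re (\<eta> \<bullet>c g) / \<sigma> = Re ((b *\<^sub>v \<eta>) \<bullet>c \<xi>) / \<sigma> + Re ((d *\<^sub>v \<eta>) \<bullet>c \<eta>) / \<sigma>"
      using arg_cong[OF g1[of \<eta>], of Re] by (simp add: add_divide_distrib[symmetric])
    show ?thesis
      using x q r by (simp add: e11 e12 e22 left_diff_distrib)
  qed
  moreover have "(\<omega>\<^sub>c\<^sup>2 - \<omega>\<^sup>2) * Re ((Q *\<^sub>v \<xi>) \<bullet>c \<xi>) \<ge> 0"
    using Q \<omega> abs_le_square_iff[of \<omega> \<omega>\<^sub>c]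
    by (intro mult_nonneg_nonneg) (auto simp: psd_def carrier_matD(1)[of Q N N])
  ultimately show ?thesis by linarith
qed

section \<open>Resolvents, reduction of realizations, and minimality\<close>

lemmas cmat_mult = of_real_hom.mat_hom_mult[where 'a = complex]
lemmas cmat_mult_vec = of_real_hom.mult_mat_vec_hom[where 'a = complex]

lemma pencil_carrier [simp]: "A \<in> carrier_mat n n \<Longrightarrow> pencil A s \<in> carrier_mat n n"
  by (auto simp: pencil_def minus_carrier_mat)

text \<open>A nonzero determinant makes the pencil a unit of the matrix ring, which rules out the
  result \<open>None\<close> of \<open>mat_inverse\<close>; so \<open>the\<close> yields a genuine
  two-sided inverse.\<close>

lemma pencil_inverse:
  assumes "A \<in> carrier_mat n n" "det (pencil A s) \<noteq> 0"
  defines "R \<equiv> the (mat_inverse (pencil A s))"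
  shows "R \<in> carrier_mat n n" "R * pencil A s = 1\<^sub>m n" "pencil A s * R = 1\<^sub>m n"
proof -
  have P: "pencil A s \<in> carrier_mat n n" using assms by simp
  have "pencil A s \<in> Units (ring_mat TYPE(complex) n ())"
    using det_non_zero_imp_unit[OF P assms(2)] .
  then obtain R' where "mat_inverse (pencil A s) = Some R'"
    using mat_inverse(1)[OF P, where b = "()"] by (cases "mat_inverse (pencil A s)") auto
  with mat_inverse(2)[OF P this]
  show "R \<in> carrier_mat n n" "R * pencil A s = 1\<^sub>m n" "pencil A s * R = 1\<^sub>m n"
    by (simp_all add: R_def)
qed

text \<open>The intertwining \<open>A * T = T * A'\<close> passes to the resolvents,
  \<open>T * R' = R * T\<close> over the complex numbers, and then
  \<open>C * R * B = C * R * T * B' = C * T * R' * B'\<close>. The map \<open>T\<close> may be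
  rectangular and need not be injective.\<close>

lemma intertwined_same_tf:
  assumes "siso_dims n A B C D" "siso_dims k A' B' (C * T) D" and T: "T \<in> carrier_mat n k"
    and AT: "A * T = T * A'" and BT: "B = T * B'"
  shows "same_tf A B C D A' B' (C * T) D"
  unfolding same_tf_def
proof (intro allI impI)
  fix s assume det: "det (pencil A s) \<noteq> 0 \<and> det (pencil A' s) \<noteq> 0"
  have c: "A \<in> carrier_mat n n" "B \<in> carrier_mat n 1" "C \<in> carrier_mat 1 n"
    "A' \<in> carrier_mat k k" "B' \<in> carrier_mat k 1"
    using assms(1,2) by (simp_all add: siso_dims_def)
  define R where "R = the (mat_inverse (pencil A s))"
  define R' where "R' = the (mat_inverse (pencil A' s))"
  note R = pencil_inverse[OF c(1) conjunct1[OF det], folded R_def]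
    and R' = pencil_inverse[OF c(4) conjunct2[OF det], folded R'_def]
  let ?T = "cmat T"
  have cc: "cmat A \<in> carrier_mat n n" "cmat B \<in> carrier_mat n 1" "cmat C \<in> carrier_mat 1 n"
    "cmat A' \<in> carrier_mat k k" "cmat B' \<in> carrier_mat k 1" "?T \<in> carrier_mat n k"
    using c T by simp_all
  have "cmat A * ?T = ?T * cmat A'"
    using AT cmat_mult[OF c(1) T] cmat_mult[OF T c(4)] by simp
  then have "pencil A s * ?T = ?T * pencil A' s"
    using cc c by (simp add: pencil_def minus_mult_distrib_mat[of _ n n _ _ k]
        mult_minus_distrib_mat[of _ n k _ k] mult_smult_assoc_mat[of _ n n _ k] mult_smult_distrib[of _ n k _ k])
  \<comment> \<open>Multiplying by one resolvent on each side cancels one pencil in each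
    expression.\<close>
  then have "R * (pencil A s * ?T) * R' = R * (?T * pencil A' s) * R'"
    by simp
  also have "R * (pencil A s * ?T) * R' = ?T * R'"
    using R R' cc c by (simp add: assoc_mult_mat[of _ n n _ n, symmetric])
  also have "R * (?T * pencil A' s) * R' = R * ?T"
    using R R' cc c by (simp add: assoc_mult_mat[of _ n k _ k] assoc_mult_mat[of _ n n _ k])
  finally have TR: "?T * R' = R * ?T" .
  have "cmat C * R * cmat B = cmat C * R * (?T * cmat B')"
    using BT cmat_mult[OF T c(5)] by simp
  also have "\<dots> = cmat C * (R * ?T) * cmat B'"
    using R cc by (simp add: assoc_mult_mat[of _ "Suc 0" n _ k _ "Suc 0"] assoc_mult_mat[of _ "Suc 0" n _ n _ "Suc 0"]
        assoc_mult_mat[of _ "Suc 0" n _ n _ k] assoc_mult_mat[of _ n n _ k _ "Suc 0"]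
        mult_carrier_mat[of _ n n _ k] assoc_mult_mat[of _ n n _ k]
        mult_carrier_mat[of _ n k _ "Suc 0"])
  also have "\<dots> = cmat C * ?T * R' * cmat B'"
    using R' cc by (simp add: TR[symmetric] assoc_mult_mat[of _ "Suc 0" n _ k])
  also have "cmat C * ?T = cmat (C * T)"
    using cmat_mult[OF c(3) T] by simp
  finally show "siso_tf A B C D s = siso_tf A' B' (C * T) D s"
    by (simp add: siso_tf_def R_def R'_def)
qed

text \<open>The direction of the Popov-Belevitch-Hautus test that starts from minimality. A left
  eigenvector annihilated by \<open>B\<close> annihilates the whole Krylov sequence
  \<open>v\<close>, and a linear dependency in that sequence gives a realization with fewer
  states.\<close>

lemma minimal_controllable:
  assumes min: "minimal_realization n A B C D"
    and z: "z \<in> carrier_vec n" "z \<noteq> 0\<^sub>v n"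
    and eig: "transpose_mat (cmat A) *\<^sub>v z = \<mu> \<cdot>\<^sub>v z"
  shows "(transpose_mat (cmat B) *\<^sub>v z) $ 0 \<noteq> 0"
proof
  assume B0: "(transpose_mat (cmat B) *\<^sub>v z) $ 0 = 0"
  have dims: "siso_dims n A B C D" using min by (simp add: minimal_realization_def)
  then have c: "A \<in> carrier_mat n n" "B \<in> carrier_mat n 1" "C \<in> carrier_mat 1 n" "D \<in> carrier_mat 1 1"
    by (simp_all add: siso_dims_def)
  define v where "v j = ((\<lambda>x. A *\<^sub>v x) ^^ j) (col B 0)" for j
  have v [simp]: "v j \<in> carrier_vec n" for j
    by (induction j) (use c in \<open>auto simp: v_def\<close>)
  have v_dim [simp]: "dim_vec (v j) = n" for j using v by (rule carrier_vecD)
  have v_Suc: "v (Suc j) = A *\<^sub>v v j" for j by (simp add: v_def)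
  \<comment> \<open>By \<open>eig\<close>, one application of \<open>A\<close> multiplies the
    pairing with \<open>z\<close> by \<open>\<mu>\<close>. The pairing is bilinear, without
    conjugation.\<close>
  have ann: "map_vec complex_of_real (v j) \<bullet> z = 0" for j
  proof (induction j)
    case 0
    have "map_vec complex_of_real (v 0) = row (transpose_mat (cmat B)) 0"
      using c by (intro eq_vecI) (auto simp: v_def)
    then show ?case using B0 c by simp
  next
    case (Suc j)
    have "map_vec complex_of_real (v (Suc j)) \<bullet> z = z \<bullet> (cmat A *\<^sub>v map_vec complex_of_real (v j))"
      using c z cmat_mult_vec[OF c(1) v] by (simp add: v_Suc comm_scalar_prod[of _ n])
    also have "\<dots> = (transpose_mat (cmat A) *\<^sub>v z) \<bullet> map_vec complex_of_real (v j)"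
      using c z by (intro transpose_vec_mult_scalar[symmetric]) auto
    also have "\<dots> = \<mu> * (map_vec complex_of_real (v j) \<bullet> z)"
      using z by (simp add: eig comm_scalar_prod[of z n])
    finally show ?case using Suc by simp
  qed
  define K where "K = mat n n (\<lambda>(i, j). v j $ i)"
  have Kc: "K \<in> carrier_mat n n" by (simp add: K_def)
  have "transpose_mat (cmat K) *\<^sub>v z = 0\<^sub>v n"
  proof (intro eq_vecI)
    fix j assume j: "j < dim_vec (0\<^sub>v n :: complex vec)"
    then have "row (transpose_mat (cmat K)) j = map_vec complex_of_real (v j)"
      by (intro eq_vecI) (auto simp: K_def)
    then show "(transpose_mat (cmat K) *\<^sub>v z) $ j = 0\<^sub>v n $ j"
      using ann j by (simp add: K_def)
  qed (simp add: K_def)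
  then have "det (transpose_mat (cmat K)) = 0"
    using z Kc by (subst det_0_iff_vec_prod_zero[of _ n]) auto
  \<comment> \<open>Although \<open>z\<close> is complex, the determinant carries singularity back
    to the real matrix \<open>K\<close>. The dependency \<open>w\<close> is therefore real, as a
    real realization requires.\<close>
  then have "det K = 0"
    using Kc by (simp add: det_transpose[of _ n])
  then obtain w where w: "w \<in> carrier_vec n" "w \<noteq> 0\<^sub>v n" "K *\<^sub>v w = 0\<^sub>v n"
    using det_0_iff_vec_prod_zero[OF Kc] by auto
  \<comment> \<open>With the last nonzero coefficient at index \<open>k\<close>, the vector
    \<open>v k\<close> is a combination of the earlier ones. If \<open>k = 0\<close>, then
    \<open>v 0\<close> vanishes and the reduced realization has no states.\<close>
  define k where "k = Max {i. i < n \<and> w $ i \<noteq> 0}"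
  have "{i. i < n \<and> w $ i \<noteq> 0} \<noteq> {}"
    using w by (auto simp: vec_eq_iff)
  then have "k \<in> {i. i < n \<and> w $ i \<noteq> 0}"
    unfolding k_def by (intro Max_in) auto
  then have k: "k < n" "w $ k \<noteq> 0" by auto
  have k_max: "w $ i = 0" if "k < i" "i < n" for i
  proof (rule ccontr)
    assume "w $ i \<noteq> 0"
    then have "i \<le> k" unfolding k_def using that by (intro Max_ge) auto
    with that show False by simp
  qed
  have vk: "v k $ i = (\<Sum>l<k. v l $ i * (- w $ l / w $ k))" if "i < n" for i
  proof -
    have "0 = (K *\<^sub>v w) $ i" using w that by simp
    also have "\<dots> = (\<Sum>l<n. v l $ i * w $ l)"
      using that carrier_vecD[OF w(1)] by (simp add: K_def scalar_prod_def atLeast0LessThan)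
    also have "\<dots> = (\<Sum>l\<le>k. v l $ i * w $ l)"
      using k k_max by (intro sum.mono_neutral_right) auto
    also have "\<dots> = (\<Sum>l<k. v l $ i * w $ l) + v k $ i * w $ k"
      by (simp add: lessThan_Suc_atMost[symmetric])
    finally show ?thesis
      using k by (simp add: sum_negf sum_divide_distrib[symmetric] field_simps)
  qed
  define T where "T = mat n k (\<lambda>(i, j). v j $ i)"
  \<comment> \<open>A companion matrix: \<open>A\<close> shifts each Krylov vector to the next one,
    and the last column expresses \<open>v k\<close> through the earlier vectors by
    \<open>vk\<close>. Since \<open>v 0\<close> is the column of \<open>B\<close>, the input matrix
    \<open>B'\<close> is the first unit vector.\<close>
  define A' where "A' = mat k k (\<lambda>(i, j). if Suc j < k then (if i = Suc j then 1 else 0) else - w $ i / w $ k)"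
  define B' where "B' = mat k 1 (\<lambda>(i, j). if i = 0 then 1 else (0 :: real))"
  have T: "T \<in> carrier_mat n k" by (simp add: T_def)
  have dims': "siso_dims k A' B' (C * T) D"
    using c by (auto simp: siso_dims_def A'_def B'_def T_def)
  have "A * T = T * A'"
  proof (intro eq_matI)
    fix i j assume "i < dim_row (T * A')" "j < dim_col (T * A')"
    then have ij: "i < n" "j < k" by (auto simp: T_def A'_def)
    have "col T j = v j" using ij by (intro eq_vecI) (auto simp: T_def)
    then have "(A * T) $$ (i, j) = v (Suc j) $ i"
      using ij c T by (simp add: v_Suc)
    also have "\<dots> = (\<Sum>l<k. v l $ i * A' $$ (l, j))"
    proof (cases "Suc j < k")
      case True
      have "(\<Sum>l<k. v l $ i * A' $$ (l, j)) = (\<Sum>l<k. if l = Suc j then v l $ i else 0)"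
        using True ij by (intro sum.cong) (auto simp: A'_def)
      then show ?thesis using True by simp
    next
      case False
      then have "Suc j = k" using ij by simp
      then show ?thesis using ij vk[of i] by (simp add: A'_def)
    qed
    also have "\<dots> = (T * A') $$ (i, j)"
      using ij by (simp add: T_def A'_def scalar_prod_def atLeast0LessThan)
    finally show "(A * T) $$ (i, j) = (T * A') $$ (i, j)" .
  qed (use c in \<open>auto simp: T_def A'_def\<close>)
  moreover have "B = T * B'"
  proof (intro eq_matI)
    fix i j assume "i < dim_row (T * B')" "j < dim_col (T * B')"
    then have ij: "i < n" "j = 0" by (auto simp: T_def B'_def)
    have "(T * B') $$ (i, 0) = (\<Sum>l<k. v l $ i * (if l = 0 then 1 else 0))"
      using ij by (simp add: T_def B'_def scalar_prod_def atLeast0LessThan)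
    also have "\<dots> = (\<Sum>l<k. if l = 0 then v l $ i else 0)"
      by (intro sum.cong) auto
    \<comment> \<open>For \<open>k = 0\<close> the sum is empty, and \<open>vk\<close> says that
      \<open>v 0 $ i\<close> is zero as well.\<close>
    also have "\<dots> = v 0 $ i"
      using vk[of i] ij by (cases "k = 0") auto
    finally show "B $$ (i, j) = (T * B') $$ (i, j)"
      using ij c by (simp add: v_def)
  qed (use c in \<open>auto simp: T_def B'_def\<close>)
  ultimately have "same_tf A B C D A' B' (C * T) D"
    by (intro intertwined_same_tf[OF dims dims' T])
  with dims' have "n \<le> k"
    using min unfolding minimal_realization_def by blast
  with k show False by simp
qed

section \<open>Transposed loop matrices acting on a controller part and a plant part\<close>

lemma loop_A_transpose_mult:
  assumes "A \<in> carrier_mat n n" "B \<in> carrier_mat n 1" "x \<in> carrier_vec 1" "z \<in> carrier_vec n"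
  shows "transpose_mat (cmat (loop_A \<epsilon> A B)) *\<^sub>v (x @\<^sub>v z)
    = ((- complex_of_real \<epsilon>) \<cdot>\<^sub>v x + transpose_mat (cmat B) *\<^sub>v z) @\<^sub>v (transpose_mat (cmat A) *\<^sub>v z)"
proof -
  have "transpose_mat (cmat (loop_A \<epsilon> A B)) = four_block_mat ((- complex_of_real \<epsilon>) \<cdot>\<^sub>m 1\<^sub>m 1)
      (transpose_mat (cmat B)) (0\<^sub>m n 1) (transpose_mat (cmat A))"
    using assms by (intro eq_matI) (auto simp: loop_A_def)
  moreover have "((- complex_of_real \<epsilon>) \<cdot>\<^sub>m 1\<^sub>m 1) *\<^sub>v x = (- complex_of_real \<epsilon>) \<cdot>\<^sub>v x"
    using assms(3) by (intro eq_vecI) auto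
  moreover have "0\<^sub>m n 1 *\<^sub>v x = 0\<^sub>v n"
    using assms(3) by (intro eq_vecI) auto
  ultimately show ?thesis
    using assms four_block_mat_mult_vec[of "(- complex_of_real \<epsilon>) \<cdot>\<^sub>m 1\<^sub>m 1" 1 1 "transpose_mat (cmat B)" n
        "0\<^sub>m n 1" n "transpose_mat (cmat A)" x z]
    by (simp add: mult_mat_vec_carrier[of _ n n])
qed

lemma loop_C_transpose_mult:
  assumes "C \<in> carrier_mat 1 n" "D \<in> carrier_mat 1 1" "y \<in> carrier_vec 1"
  shows "transpose_mat (cmat (loop_C C D)) *\<^sub>v y = (transpose_mat (cmat D) *\<^sub>v y) @\<^sub>v (transpose_mat (cmat C) *\<^sub>v y)"
proof -
  have "transpose_mat (cmat (loop_C C D)) = transpose_mat (cmat D) @\<^sub>r transpose_mat (cmat C)"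
    using assms by (intro eq_matI) (auto simp: loop_C_def append_cols_def append_rows_def)
  then show ?thesis using assms by (simp add: mat_mult_append[of _ 1 1 _ n])
qed

lemma loop_MB_gain:
  assumes "B \<in> carrier_mat n 1" "x \<in> carrier_vec 1" "z \<in> carrier_vec n"
  shows "loop_MB B * gain_vec kp ki \<in> carrier_mat (1 + n) 1"
    and "transpose_mat (cmat (loop_MB B * gain_vec kp ki)) *\<^sub>v (x @\<^sub>v z)
      = complex_of_real ki \<cdot>\<^sub>v x + complex_of_real kp \<cdot>\<^sub>v (transpose_mat (cmat B) *\<^sub>v z)"
proof -
  \<comment> \<open>The integral gain drives the controller state and the proportional gain drives
    the plant through \<open>B\<close>, so the product stacks \<open>ki\<close> over
    \<open>kp \<cdot>\<^sub>m B\<close>.\<close>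
  have eq: "loop_MB B * gain_vec kp ki = (ki \<cdot>\<^sub>m 1\<^sub>m 1) @\<^sub>r (kp \<cdot>\<^sub>m B)"
    using assms by (intro eq_matI)
      (auto simp: loop_MB_def gain_vec_def append_rows_def mat_of_rows_list_def scalar_prod_def
        numeral_2_eq_2 less_Suc_eq nth_Cons')
  show "loop_MB B * gain_vec kp ki \<in> carrier_mat (1 + n) 1"
    unfolding eq using assms by (intro carrier_append_rows) auto
  have "transpose_mat (cmat (loop_MB B * gain_vec kp ki))
      = complex_of_real ki \<cdot>\<^sub>m 1\<^sub>m 1 @\<^sub>c complex_of_real kp \<cdot>\<^sub>m transpose_mat (cmat B)"
    unfolding eq using assms by (intro eq_matI) (auto simp: append_rows_def append_cols_def)
  then show "transpose_mat (cmat (loop_MB B * gain_vec kp ki)) *\<^sub>v (x @\<^sub>v z)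
      = complex_of_real ki \<cdot>\<^sub>v x + complex_of_real kp \<cdot>\<^sub>v (transpose_mat (cmat B) *\<^sub>v z)"
    using assms append_cols_mult_vec[of "complex_of_real ki \<cdot>\<^sub>m 1\<^sub>m 1" 1 1
        "complex_of_real kp \<cdot>\<^sub>m transpose_mat (cmat B)" n x z]
    by (simp add: smult_mat_mult_vec[of _ 1 1] smult_mat_mult_vec[of _ 1 n])
qed

lemma loop_MD_gain:
  assumes "D \<in> carrier_mat 1 1"
  shows "loop_MD D * gain_vec kp ki = kp \<cdot>\<^sub>m D"
  using assms by (intro eq_matI)
    (auto simp: loop_MD_def gain_vec_def append_cols_def mat_of_rows_list_def scalar_prod_def numeral_2_eq_2)


section \<open>Left eigenvectors and the adjoint resolvent\<close>

lemma pencil_transpose_mult: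
  assumes "A \<in> carrier_mat n n" "z \<in> carrier_vec n"
  shows "transpose_mat (pencil A s) *\<^sub>v z = s \<cdot>\<^sub>v z - transpose_mat (cmat A) *\<^sub>v z"
proof -
  have "transpose_mat (pencil A s) = s \<cdot>\<^sub>m 1\<^sub>m n - transpose_mat (cmat A)"
    using assms by (intro eq_matI) (auto simp: pencil_def)
  then show ?thesis
    using assms by (simp add: minus_mult_distrib_mat_vec[of _ n n] smult_mat_mult_vec[of _ n n])
qed

text \<open>Because \<open>A\<close> is real, conjugation maps the pencil at \<open>s\<close> to the
  pencil at \<open>cnj s\<close>, so both are singular together. A kernel vector of the transposed
  pencil at \<open>cnj s\<close> is then the required eigenvector.\<close>

lemma pencil_left_eigenvector:
  assumes A: "A \<in> carrier_mat n n" and det: "det (pencil A s) = 0"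
  obtains z where "z \<in> carrier_vec n" "z \<noteq> 0\<^sub>v n" "transpose_mat (cmat A) *\<^sub>v z = cnj s \<cdot>\<^sub>v z"
proof -
  interpret cnj_hom: comm_ring_hom cnj by unfold_locales auto
  have "pencil A (cnj s) = map_mat cnj (pencil A s)"
    using A by (intro eq_matI) (auto simp: pencil_def)
  then have "det (transpose_mat (pencil A (cnj s))) = 0"
    using A det by (subst det_transpose[of _ n]) auto
  then obtain z where z: "z \<in> carrier_vec n" "z \<noteq> 0\<^sub>v n" "transpose_mat (pencil A (cnj s)) *\<^sub>v z = 0\<^sub>v n"
    using A det_0_iff_vec_prod_zero[of "transpose_mat (pencil A (cnj s))" n] by auto
  have diff: "cnj s \<cdot>\<^sub>v z - transpose_mat (cmat A) *\<^sub>v z = 0\<^sub>v n"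
    using pencil_transpose_mult[OF A z(1), of "cnj s"] z(3) by simp
  have "(cnj s \<cdot>\<^sub>v z - transpose_mat (cmat A) *\<^sub>v z) $ i = 0" if "i < n" for i
    unfolding diff using that by simp
  then have "transpose_mat (cmat A) *\<^sub>v z = cnj s \<cdot>\<^sub>v z"
    using A z(1) by (intro eq_vecI) auto
  with z that show thesis by blast
qed

text \<open>The witness is the adjoint of the resolvent applied to the transposed output row. It
  solves the adjoint state equation with unit output weight, and pairing it with \<open>B\<close>
  recovers the conjugate of the transfer function.\<close>

lemma pencil_resolvent_adjoint:
  assumes dims: "siso_dims n A B C D" and det: "det (pencil A s) \<noteq> 0"
  obtains z where "z \<in> carrier_vec n"
    "transpose_mat (cmat A) *\<^sub>v z + transpose_mat (cmat C) *\<^sub>v vec 1 (\<lambda>_. 1) = cnj s \<cdot>\<^sub>v z"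
    "(transpose_mat (cmat B) *\<^sub>v z) $ 0 + complex_of_real (D $$ (0, 0)) = cnj (siso_tf A B C D s)"
proof -
  have c: "A \<in> carrier_mat n n" "B \<in> carrier_mat n 1" "C \<in> carrier_mat 1 n" "D \<in> carrier_mat 1 1"
    using dims by (simp_all add: siso_dims_def)
  define R where "R = the (mat_inverse (pencil A s))"
  note R = pencil_inverse[OF c(1) det, folded R_def]
  define e where "e = vec 1 (\<lambda>_. 1 :: complex)"
  have e: "e \<in> carrier_vec 1" by (simp add: e_def)
  define c0 where "c0 = transpose_mat (cmat C) *\<^sub>v e"
  have c0: "c0 \<in> carrier_vec n" using c e by (auto simp: c0_def)
  define z where "z = mat_adjoint R *\<^sub>v c0"
  have z: "z \<in> carrier_vec n"
    using R(1) c0 unfolding z_def by (intro mult_mat_vec_carrier[of _ n n]) auto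
  have adjoint_pencil: "mat_adjoint (pencil A s) = transpose_mat (pencil A (cnj s))"
    using c by (intro eq_matI) (auto simp: pencil_def)
  have "mat_adjoint (pencil A s) *\<^sub>v z = (mat_adjoint (pencil A s) * mat_adjoint R) *\<^sub>v c0"
    unfolding z_def using R(1) c(1) c0 by (intro assoc_mult_mat_vec[symmetric, of _ n n _ n]) auto
  also have "mat_adjoint (pencil A s) * mat_adjoint R = mat_adjoint (R * pencil A s)"
    using R(1) c(1) by (intro mat_adjoint_mult[symmetric, of _ n n _ n]) auto
  also have "mat_adjoint (R * pencil A s) = 1\<^sub>m n"
    unfolding R(2) by (intro eq_matI) auto
  finally have c0_eq: "cnj s \<cdot>\<^sub>v z - transpose_mat (cmat A) *\<^sub>v z = c0"
    using c0 pencil_transpose_mult[OF c(1) z, of "cnj s"] by (simp add: adjoint_pencil)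
  have state: "transpose_mat (cmat A) *\<^sub>v z + c0 = cnj s \<cdot>\<^sub>v z"
    unfolding c0_eq[symmetric] using z c by (intro eq_vecI) auto
  have "siso_tf A B C D s = (cmat C * R * cmat B) $$ (0, 0) + complex_of_real (D $$ (0, 0))"
    using c R(1) by (simp add: siso_tf_def R_def)
  \<comment> \<open>Writing the single entry as a form in the unit vector \<open>e\<close> allows
    \<open>C\<close>, \<open>R\<close> and \<open>B\<close> to be moved across the product one at a
    time.\<close>
  also have "(cmat C * R * cmat B) $$ (0, 0) = ((cmat C * R * cmat B) *\<^sub>v e) \<bullet>c e"
    using c R(1) by (simp add: e_def scalar_prod_def)
  also have "\<dots> = (cmat C *\<^sub>v (R *\<^sub>v (cmat B *\<^sub>v e))) \<bullet>c e"
    using c R(1) e by (simp add: assoc_mult_mat_vec[of _ "Suc 0" n _ n] assoc_mult_mat_vec[of _ "Suc 0" n _ "Suc 0"]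
        mult_carrier_mat[of _ "Suc 0" n _ n] mult_mat_vec_carrier[of _ n "Suc 0"])
  also have "\<dots> = (R *\<^sub>v (cmat B *\<^sub>v e)) \<bullet>c c0"
    unfolding c0_def using c R(1) e
    by (subst cscalar_mult_adjoint[of _ 1 n]) (auto intro!: mult_mat_vec_carrier)
  also have "\<dots> = (cmat B *\<^sub>v e) \<bullet>c z"
    unfolding z_def using c R(1) e c0
    by (intro cscalar_mult_adjoint[of _ n n]) (auto intro!: mult_mat_vec_carrier)
  also have "\<dots> = e \<bullet>c (transpose_mat (cmat B) *\<^sub>v z)"
    using c e z by (subst cscalar_mult_adjoint[of _ n 1]) auto
  also have "\<dots> = cnj ((transpose_mat (cmat B) *\<^sub>v z) $ 0)"
    using c by (simp add: e_def scalar_prod_def)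
  finally have "cnj (siso_tf A B C D s) = (transpose_mat (cmat B) *\<^sub>v z) $ 0 + complex_of_real (D $$ (0, 0))"
    by simp
  with z state that show thesis by (simp add: c0_def e_def)
qed

section \<open>The disk condition and the conclusion\<close>

lemma PD_regionI:
  assumes "\<sigma> > 0" "(cmod z)\<^sup>2 \<le> Re z / \<sigma>"
  shows "z \<in> PD_region \<sigma>"
proof -
  \<comment> \<open>Completing the square: center and radius agree, so the constant term is exactly
    the squared radius.\<close>
  have "(cmod (z - complex_of_real (1 / (2 * \<sigma>))))\<^sup>2 = (cmod z)\<^sup>2 - Re z / \<sigma> + (1 / (2 * \<sigma>))\<^sup>2"
    using assms(1) unfolding cmod_power2 by (simp add: power2_eq_square field_simps)
  then have "(cmod (z - complex_of_real (1 / (2 * \<sigma>))))\<^sup>2 \<le> (1 / (2 * \<sigma>))\<^sup>2"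
    using assms(2) by simp
  then show ?thesis
    using assms(1) unfolding PD_region_def by (simp add: abs_le_square_iff[symmetric])
qed

theorem corollary7:
  fixes n :: nat
    and A B C D :: "real mat"
    and X Q :: "complex mat"
    and \<epsilon> kp ki \<sigma> \<omega>\<^sub>c :: real
  defines "A\<^sub>L \<equiv> cmat (loop_A \<epsilon> A B)"
    and "M\<^sub>B\<rho> \<equiv> cmat (loop_MB B * gain_vec kp ki)"
    and "C\<^sub>L \<equiv> cmat (loop_C C D)"
    and "M\<^sub>D\<rho> \<equiv> cmat (loop_MD D * gain_vec kp ki)"
  defines "\<Xi>11 \<equiv> A\<^sub>L * X + X * transpose_mat A\<^sub>L - A\<^sub>L * Q * transpose_mat A\<^sub>L
                  + complex_of_real (\<omega>\<^sub>c\<^sup>2) \<cdot>\<^sub>m Q"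
    and "\<Xi>12 \<equiv> X * transpose_mat C\<^sub>L - A\<^sub>L * Q * transpose_mat C\<^sub>L
                  - complex_of_real (1 / (2 * \<sigma>)) \<cdot>\<^sub>m M\<^sub>B\<rho>"
    and "\<Xi>22 \<equiv> - (C\<^sub>L * Q * transpose_mat C\<^sub>L) - complex_of_real (1 / \<sigma>) \<cdot>\<^sub>m M\<^sub>D\<rho>"
    and "\<Xi>13 \<equiv> M\<^sub>B\<rho>"
    and "\<Xi>23 \<equiv> M\<^sub>D\<rho>"
  assumes minimal: "minimal_realization n A B C D"
    and "\<epsilon> > 0" and "\<sigma> > 0" and "\<omega>\<^sub>c > 0"
    and "kp \<ge> 0" and "ki \<ge> 0"
    and "X \<in> carrier_mat (1 + n) (1 + n)" and "hermitian_mat X"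
    and "Q \<in> carrier_mat (1 + n) (1 + n)" and "hermitian_mat Q"
    and "psd Q"
    and LMI: "nsd (block3 \<Xi>11 \<Xi>12 \<Xi>13
                          (mat_adjoint \<Xi>12) \<Xi>22 \<Xi>23
                          (mat_adjoint \<Xi>13) (mat_adjoint \<Xi>23) (- 1\<^sub>m 1))"
  shows "\<forall>\<omega>::real. - \<omega>\<^sub>c \<le> \<omega> \<and> \<omega> \<le> \<omega>\<^sub>c \<longrightarrow>
           siso_tf A B C D (\<i> * complex_of_real \<omega>) * leaky_PI \<epsilon> kp ki (\<i> * complex_of_real \<omega>)
             \<in> PD_region \<sigma>"
proof (intro allI impI)
  fix \<omega> :: real
  assume \<omega>: "- \<omega>\<^sub>c \<le> \<omega> \<and> \<omega> \<le> \<omega>\<^sub>c"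
  define s where "s = \<i> * complex_of_real \<omega>"
  define K where "K = leaky_PI \<epsilon> kp ki s"
  have dims: "siso_dims n A B C D" using minimal by (simp add: minimal_realization_def)
  then have c: "A \<in> carrier_mat n n" "B \<in> carrier_mat n 1" "C \<in> carrier_mat 1 n" "D \<in> carrier_mat 1 1"
    by (simp_all add: siso_dims_def)
  have loop_carrier: "A\<^sub>L \<in> carrier_mat (1 + n) (1 + n)" "C\<^sub>L \<in> carrier_mat 1 (1 + n)"
    "M\<^sub>B\<rho> \<in> carrier_mat (1 + n) 1" "M\<^sub>D\<rho> \<in> carrier_mat 1 1"
    using c loop_MB_gain(1)[of B n "0\<^sub>v 1" "0\<^sub>v n"]
    by (auto simp: A\<^sub>L_def C\<^sub>L_def M\<^sub>B\<rho>_def M\<^sub>D\<rho>_def loop_A_def loop_C_def append_cols_def loop_MD_gain)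
  \<comment> \<open>The loop matrices are real, so the transposes in the matrix inequality are the
    adjoints that \<open>gkyp_test_vector\<close> speaks of.\<close>
  have adjoints: "transpose_mat A\<^sub>L = mat_adjoint A\<^sub>L" "transpose_mat C\<^sub>L = mat_adjoint C\<^sub>L"
    by (simp_all add: A\<^sub>L_def C\<^sub>L_def)
  \<comment> \<open>One bound serves both uses: \<open>e = 1\<close> with the resolvent vector, and
    \<open>e = 0\<close> with a left eigenvector of \<open>A\<close>.\<close>
  have gain_bound: "(cmod (cnj K * q))\<^sup>2 \<le> Re (cnj K * q * cnj e) / \<sigma>"
    if z: "z \<in> carrier_vec n"
      and state: "transpose_mat (cmat A) *\<^sub>v z + transpose_mat (cmat C) *\<^sub>v vec 1 (\<lambda>_. e) = cnj s \<cdot>\<^sub>v z"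
      and q: "q = (transpose_mat (cmat B) *\<^sub>v z) $ 0 + complex_of_real (D $$ (0, 0)) * e"
    for z e q
  proof -
    have s\<epsilon>: "cnj s + complex_of_real \<epsilon> \<noteq> 0"
      using \<open>\<epsilon> > 0\<close> by (simp add: s_def complex_eq_iff)
    \<comment> \<open>The controller component solves the first row of the adjoint loop equation,
      \<open>q - \<epsilon> * a = cnj s * a\<close>. The denominator is nonzero because its real
      part is \<open>\<epsilon>\<close>.\<close>
    define a where "a = q / (cnj s + complex_of_real \<epsilon>)"
    have a: "q - complex_of_real \<epsilon> * a = cnj s * a"
      using s\<epsilon> by (simp add: a_def field_simps)
    define x where "x = vec 1 (\<lambda>_. a)"
    define \<eta> where "\<eta> = vec 1 (\<lambda>_. e)"
    have x: "x \<in> carrier_vec 1" and \<eta>: "\<eta> \<in> carrier_vec 1" by (simp_all add: x_def \<eta>_def)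
    have D\<eta>: "transpose_mat (cmat D) *\<^sub>v \<eta> = vec 1 (\<lambda>_. complex_of_real (D $$ (0, 0)) * e)"
      using c by (intro eq_vecI) (auto simp: \<eta>_def scalar_prod_def)
    have Bz: "transpose_mat (cmat B) *\<^sub>v z \<in> carrier_vec 1"
      using c z by (auto intro!: mult_mat_vec_carrier)
    have "mat_adjoint A\<^sub>L *\<^sub>v (x @\<^sub>v z) + mat_adjoint C\<^sub>L *\<^sub>v \<eta>
        = ((- complex_of_real \<epsilon>) \<cdot>\<^sub>v x + transpose_mat (cmat B) *\<^sub>v z + transpose_mat (cmat D) *\<^sub>v \<eta>)
          @\<^sub>v (transpose_mat (cmat A) *\<^sub>v z + transpose_mat (cmat C) *\<^sub>v \<eta>)"
      unfolding A\<^sub>L_def C\<^sub>L_def mat_adjoint_cmat loop_A_transpose_mult[OF c(1,2) x z]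
        loop_C_transpose_mult[OF c(3,4) \<eta>]
      using c x z \<eta> Bz by (intro append_vec_add[of _ 1 _ _ n]) (auto intro!: mult_mat_vec_carrier)
    also have "(- complex_of_real \<epsilon>) \<cdot>\<^sub>v x + transpose_mat (cmat B) *\<^sub>v z + transpose_mat (cmat D) *\<^sub>v \<eta>
        = cnj s \<cdot>\<^sub>v x"
      unfolding D\<eta> using c a by (intro eq_vecI) (auto simp: x_def q algebra_simps)
    also have "transpose_mat (cmat A) *\<^sub>v z + transpose_mat (cmat C) *\<^sub>v \<eta> = cnj s \<cdot>\<^sub>v z"
      unfolding \<eta>_def by (rule state)
    also have "cnj s \<cdot>\<^sub>v x @\<^sub>v cnj s \<cdot>\<^sub>v z = cnj s \<cdot>\<^sub>v (x @\<^sub>v z)"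
      by (intro eq_vecI) auto
    finally have eq: "mat_adjoint A\<^sub>L *\<^sub>v (x @\<^sub>v z) + mat_adjoint C\<^sub>L *\<^sub>v \<eta>
        = cnj (\<i> * complex_of_real \<omega>) \<cdot>\<^sub>v (x @\<^sub>v z)"
      by (simp only: s_def)
    define g where "g = mat_adjoint M\<^sub>B\<rho> *\<^sub>v (x @\<^sub>v z) + mat_adjoint M\<^sub>D\<rho> *\<^sub>v \<eta>"
    \<comment> \<open>Conjugating the controller formula gives
      \<open>cnj K = kp + ki / (cnj s + \<epsilon>)\<close>, and the quotient times \<open>q\<close>
      is \<open>ki * a\<close>.\<close>
    have "complex_of_real ki * a + complex_of_real kp * q = cnj K * q"
      by (simp add: K_def leaky_PI_def a_def algebra_simps)
    moreover have "mat_adjoint M\<^sub>D\<rho> *\<^sub>v \<eta> = complex_of_real kp \<cdot>\<^sub>v (transpose_mat (cmat D) *\<^sub>v \<eta>)"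
      using c \<eta> by (intro eq_vecI) (auto simp: M\<^sub>D\<rho>_def loop_MD_gain scalar_prod_def \<eta>_def)
    ultimately have g: "g = vec 1 (\<lambda>_. cnj K * q)"
      unfolding g_def M\<^sub>B\<rho>_def mat_adjoint_cmat loop_MB_gain(2)[OF c(2) x z] D\<eta>
      using c by (intro eq_vecI) (auto simp: x_def q M\<^sub>B\<rho>_def D\<eta> algebra_simps)
    have "x @\<^sub>v z \<in> carrier_vec (1 + n)" "\<bar>\<omega>\<bar> \<le> \<omega>\<^sub>c"
      using append_carrier_vec[OF x z] \<omega> by auto
    note loop_carrier = loop_carrier this
    have "Re (g \<bullet>c g) \<le> Re (\<eta> \<bullet>c g) / \<sigma>"
      unfolding g_def
    proof (rule gkyp_test_vector[where A = A\<^sub>L and C = C\<^sub>L and X = X and Q = Q and N = "1 + n" and m = 1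
          and \<omega> = \<omega> and \<omega>\<^sub>c = \<omega>\<^sub>c])
      show "nsd (block3 (A\<^sub>L * X + X * mat_adjoint A\<^sub>L - A\<^sub>L * Q * mat_adjoint A\<^sub>L + complex_of_real (\<omega>\<^sub>c\<^sup>2) \<cdot>\<^sub>m Q)
          (X * mat_adjoint C\<^sub>L - A\<^sub>L * Q * mat_adjoint C\<^sub>L - complex_of_real (1 / (2 * \<sigma>)) \<cdot>\<^sub>m M\<^sub>B\<rho>) M\<^sub>B\<rho>
          (mat_adjoint (X * mat_adjoint C\<^sub>L - A\<^sub>L * Q * mat_adjoint C\<^sub>L - complex_of_real (1 / (2 * \<sigma>)) \<cdot>\<^sub>m M\<^sub>B\<rho>))
          (- (C\<^sub>L * Q * mat_adjoint C\<^sub>L) - complex_of_real (1 / \<sigma>) \<cdot>\<^sub>m M\<^sub>D\<rho>) M\<^sub>D\<rho>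
          (mat_adjoint M\<^sub>B\<rho>) (mat_adjoint M\<^sub>D\<rho>) (- 1\<^sub>m 1))"
        using LMI unfolding \<Xi>11_def \<Xi>12_def \<Xi>22_def \<Xi>13_def \<Xi>23_def adjoints .
    qed (use loop_carrier \<open>X \<in> _\<close> \<open>hermitian_mat X\<close> \<open>Q \<in> _\<close> \<open>psd Q\<close> \<eta> eq in simp_all)
    then show ?thesis
      unfolding g \<eta>_def cmod_power2 by (simp add: scalar_prod_def power2_eq_square algebra_simps)
  qed
  have "siso_tf A B C D s * K \<in> PD_region \<sigma>"
  \<comment> \<open>Splitting on \<open>K\<close> instead of on the determinant: a zero gain makes
    the product 0, a point of the disk, whatever value \<open>siso_tf\<close> takes.\<close>
  proof (cases "K = 0")
    case True
    then show ?thesis using \<open>\<sigma> > 0\<close> by (intro PD_regionI) simp_all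
  next
    case K: False
    have "det (pencil A s) \<noteq> 0"
    proof
      assume "det (pencil A s) = 0"
      then obtain z where z: "z \<in> carrier_vec n" "z \<noteq> 0\<^sub>v n" "transpose_mat (cmat A) *\<^sub>v z = cnj s \<cdot>\<^sub>v z"
        by (rule pencil_left_eigenvector[OF c(1)])
      have "transpose_mat (cmat C) *\<^sub>v vec 1 (\<lambda>_. 0) = 0\<^sub>v n"
        using c by (intro eq_vecI) (auto simp: scalar_prod_def)
      \<comment> \<open>With \<open>e = 0\<close> the right-hand side of the bound is 0, which
        forces the squared modulus to vanish.\<close>
      with gain_bound[OF z(1), of 0 "(transpose_mat (cmat B) *\<^sub>v z) $ 0"]
      have "cnj K * (transpose_mat (cmat B) *\<^sub>v z) $ 0 = 0"
        using z(1,3) by simp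
      with K minimal_controllable[OF minimal z] show False by simp
    qed
    then obtain z where "z \<in> carrier_vec n"
      "transpose_mat (cmat A) *\<^sub>v z + transpose_mat (cmat C) *\<^sub>v vec 1 (\<lambda>_. 1) = cnj s \<cdot>\<^sub>v z"
      "(transpose_mat (cmat B) *\<^sub>v z) $ 0 + complex_of_real (D $$ (0, 0)) = cnj (siso_tf A B C D s)"
      by (rule pencil_resolvent_adjoint[OF dims])
    \<comment> \<open>The bound concerns the conjugate of the open-loop value; modulus and real part
      are unchanged by conjugation.\<close>
    then have "(cmod (cnj K * cnj (siso_tf A B C D s)))\<^sup>2 \<le> Re (cnj K * cnj (siso_tf A B C D s)) / \<sigma>"
      using gain_bound[of z 1 "cnj (siso_tf A B C D s)"] by simp
    then show ?thesis
      using \<open>\<sigma> > 0\<close> by (intro PD_regionI) (simp_all add: norm_mult mult.commute)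
  qed
  then show "siso_tf A B C D (\<i> * complex_of_real \<omega>) * leaky_PI \<epsilon> kp ki (\<i> * complex_of_real \<omega>)
      \<in> PD_region \<sigma>"
    by (simp add: s_def K_def)
qed

end
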